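(* For every $n\ge2$, the statistics $w\mapsto\mathbf{F}\,w$ and $w\mapsto n-\mathbf{NL}\,w$ on $\mathrm{And}_n^{I}$ are both Entringerian, i.e. for every $m\in\{1,\dots,n\}$, $\#\{w\in\mathrm{And}_n^{I}:\mathbf{F}\,w=m\}=\#\{w\in\mathrm{And}_n^{I}:n-\mathbf{NL}\,w=m\}=E_n(m)$ (and $\#\mathrm{And}_n^I=E_n$). Moreover the joint distribution of $(\mathbf{F},\,n-\mathbf{NL})$ on $\mathrm{And}_n^{I}$ is symmetric: for all integers $p,q$, $\#\{w:(\mathbf{F}\,w,n-\mathbf{NL}\,w)=(p,q)\}=\#\{w:(\mathbf{F}\,w,n-\mathbf{NL}\,w)=(q,p)\}$.
   Context: Andr\'e I permutations: words are permutations of finite sets $Y$ of positive integers; the empty word and one-letter words are Andr\'e I; for $|Y|\ge2$ write $w=v\,\min(w)\,v'$; $w$ is Andr\'e I if $v,v'$ are Andr\'e I and $\max(vv')$ is a letter of $v'$. $\mathrm{And}_n^{I}$: Andr\'e I permutations of $\{1,\dots,n\}$. For $w=x_1\cdots x_n$: $\mathbf{F}\,w=x_1$, $\mathbf{NL}\,w=x_{n-1}$. $E_n$: $\sum_{n\ge0}E_nu^n/n!=\tan u+\sec u$. Entringer numbers $E_n(m)$ ($1\le m\le n$): $E_1(1)=1$, $E_n(n)=0$ for $n\ge2$, $E_n(m+1)-E_n(m)+E_{n-1}(n-m)=0$ for $n\ge2$, $1\le m\le n-1$. *)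

theory Defs
  imports
    "HOL-Combinatorics.Multiset_Permutations"
    "HOL-Computational_Algebra.Formal_Power_Series"
begin

inductive andre_I :: "nat list \<Rightarrow> bool" where
  Nil: "andre_I []"
| singleton: "0 < x \<Longrightarrow> andre_I [x]"
| split: "\<lbrakk>v @ v' \<noteq> []; 0 < x; distinct (v @ x # v'); x = Min (set (v @ x # v'));
    andre_I v; andre_I v'; Max (set (v @ v')) \<in> set v'\<rbrakk> \<Longrightarrow> andre_I (v @ x # v')"

definition And_I :: "nat \<Rightarrow> nat list set" where
  "And_I n = {w \<in> permutations_of_set {1..n}. andre_I w}"

definition first_letter :: "nat list \<Rightarrow> nat" where
  "first_letter w = hd w"

(* x_{n-1} in the word x_1 ... x_n; meaningful for words of length at least 2 *)
definition next_to_last :: "nat list \<Rightarrow> nat" where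
  "next_to_last w = w ! (length w - 2)"

definition euler_number :: "nat \<Rightarrow> real" where
  "euler_number n = fact n * fps_nth (fps_tan 1 + inverse (fps_cos 1)) n"

(* Meaningful for 1 \<le> m \<le> n, with junk value 0 outside this range. On it, E_n(m) is obtained by
   downward recursion on m from E_n(n); the lemmas below restate the recurrence. *)
function entringer :: "nat \<Rightarrow> nat \<Rightarrow> nat" where
  "entringer n m =
    (if n = 1 \<and> m = 1 then 1
     else if 1 \<le> m \<and> m < n then entringer n (m + 1) + entringer (n - 1) (n - m)
     else 0)"
  by pat_completeness auto
termination by (relation "measures [\<lambda>(n, m). n, \<lambda>(n, m). n - m]") auto

declare entringer.simps [simp del]

lemma entringer_1_1: "entringer 1 1 = 1"
  by (simp add: entringer.simps)

lemma entringer_diag: "n \<ge> 2 \<Longrightarrow> entringer n n = 0"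
  by (simp add: entringer.simps)

lemma entringer_rec:
  assumes "n \<ge> 2" "1 \<le> m" "m \<le> n - 1"
  shows "int (entringer n (m + 1)) - int (entringer n m) + int (entringer (n - 1) (n - m)) = 0"
  using assms by (simp add: entringer.simps [of n m])

end

theory Submission imports Defs begin

text \<open>
  Cutting a word at its minimum splits the remaining letters over two shorter words, the right one
  containing the maximum. In terms of exponential generating functions with one variable for each
  range of labels (below, between, above the marked letters), this gives differential equations
  with explicit solutions. Let \<open>E = tan + sec\<close> be taken in the sum of all variables, so that
  \<open>E'' = E E'\<close>, and let \<open>x\<close> and \<open>z\<close> be the variables of the labels below and above the marked
  letters. Then words are counted by \<open>E\<close>, words with prescribed first letter by
  \<open>cos z + E sin z\<close>, words with prescribed next-to-last letter by \<open>E' cos z\<close>, and words with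
  prescribed first letter \<open>p\<close> and next-to-last letter \<open>r\<close> by \<open>E' cos x cos z\<close> if \<open>p < r\<close> and by
  \<open>cos x cos z + E sin (x + z) + (E' - 1) sin x sin z\<close> if \<open>r < p\<close>. Both are symmetric in \<open>x\<close> and
  \<open>z\<close>, which is the symmetry of the joint distribution. The Entringer recurrence is the identity
  \<open>(\<partial>\<^sub>z - \<partial>\<^sub>x) (cos z + E sin z) = E cos z - sin z = cos x + E sin x\<close>.
\<close>

section \<open>Set power series\<close>

text \<open>
  Multivariate exponential generating functions without repeated variables, modelled as functions
  of the finite set of variables. The product distributes the variables over the two factors, so no
  binomial coefficients occur.
\<close>

typedef (overloaded) ('a, 'b) sps = "{f :: 'a set \<Rightarrow> 'b :: zero. \<forall>S. infinite S \<longrightarrow> f S = 0}"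
  morphisms sps_nth Abs_sps
  by (rule exI [of _ "\<lambda>_. 0"]) simp

setup_lifting type_definition_sps

lemma sps_ext: "(\<And>S. finite S \<Longrightarrow> sps_nth f S = sps_nth g S) \<Longrightarrow> f = g"
  by transfer (metis ext)

definition subset_convolution ::
    "('a set \<Rightarrow> 'b :: comm_ring_1) \<Rightarrow> ('a set \<Rightarrow> 'b) \<Rightarrow> 'a set \<Rightarrow> 'b" where
  "subset_convolution f g S = (\<Sum>T\<in>Pow S. f T * g (S - T))"

lemma subset_convolution_commute: "subset_convolution f g S = subset_convolution g f S"
  unfolding subset_convolution_def
  by (rule sum.reindex_bij_witness [of _ "\<lambda>T. S - T" "\<lambda>T. S - T"])
     (auto simp: double_diff mult.commute)

lemma subset_convolution_assoc:
  assumes "finite S"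
  shows "subset_convolution (subset_convolution f g) h S =
    subset_convolution f (subset_convolution g h) S"
proof -
  have Diff_Diff_Diff: "S - U - (T - U) = S - T" if "U \<subseteq> T" for T U :: "'a set"
    using that by auto
  have "subset_convolution (subset_convolution f g) h S =
      (\<Sum>T\<in>Pow S. \<Sum>U\<in>Pow T. f U * g (T - U) * h (S - T))"
    by (simp add: subset_convolution_def sum_distrib_right)
  also have "\<dots> = (\<Sum>(T, U)\<in>(SIGMA T:Pow S. Pow T). f U * g (T - U) * h (S - T))"
    using assms by (intro sum.Sigma) (auto intro: finite_subset)
  also have "\<dots> = (\<Sum>(U, V)\<in>(SIGMA U:Pow S. Pow (S - U)). f U * (g V * h (S - U - V)))"
    by (rule sum.reindex_bij_witness [of _ "\<lambda>(U, V). (U \<union> V, U)" "\<lambda>(T, U). (U, T - U)"])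
       (auto simp: Diff_Diff_Diff mult.assoc)
  also have "\<dots> = (\<Sum>U\<in>Pow S. \<Sum>V\<in>Pow (S - U). f U * (g V * h (S - U - V)))"
    using assms by (intro sum.Sigma [symmetric]) (auto intro: finite_subset)
  also have "\<dots> = subset_convolution f (subset_convolution g h) S"
    by (simp add: subset_convolution_def sum_distrib_left)
  finally show ?thesis .
qed

lemma subset_convolution_one:
  "finite S \<Longrightarrow> subset_convolution (\<lambda>S. if S = {} then 1 else 0) f S = f S"
  by (simp add: subset_convolution_def if_distrib [where f = "\<lambda>x. x * _"] sum.delta cong: if_cong)

instantiation sps :: (type, comm_ring_1) comm_ring_1
begin

lift_definition zero_sps :: "('a, 'b) sps" is "\<lambda>_. 0" by simp
lift_definition one_sps :: "('a, 'b) sps" is "\<lambda>S. if S = {} then 1 else 0" by auto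
lift_definition plus_sps :: "('a, 'b) sps \<Rightarrow> ('a, 'b) sps \<Rightarrow> ('a, 'b) sps" is
  "\<lambda>f g S. f S + g S" by simp
lift_definition minus_sps :: "('a, 'b) sps \<Rightarrow> ('a, 'b) sps \<Rightarrow> ('a, 'b) sps" is
  "\<lambda>f g S. f S - g S" by simp
lift_definition uminus_sps :: "('a, 'b) sps \<Rightarrow> ('a, 'b) sps" is "\<lambda>f S. - f S" by simp
lift_definition times_sps :: "('a, 'b) sps \<Rightarrow> ('a, 'b) sps \<Rightarrow> ('a, 'b) sps" is subset_convolution
  by (simp add: subset_convolution_def)

instance
proof
  fix f g h :: "('a, 'b) sps"
  show "f * g * h = f * (g * h)"
  proof (rule sps_ext)
    fix S :: "'a set"
    assume "finite S"
    thus "sps_nth (f * g * h) S = sps_nth (f * (g * h)) S"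
      by transfer (rule subset_convolution_assoc)
  qed
  show "f * g = g * f"
    by transfer (simp add: fun_eq_iff subset_convolution_commute)
  show "1 * f = f"
  proof (rule sps_ext)
    fix S :: "'a set"
    assume "finite S"
    thus "sps_nth (1 * f) S = sps_nth f S"
      by transfer (simp add: subset_convolution_one)
  qed
  show "(f + g) * h = f * h + g * h"
    by transfer (simp add: fun_eq_iff subset_convolution_def distrib_right sum.distrib)
  show "(0 :: ('a, 'b) sps) \<noteq> 1"
    by transfer (metis zero_neq_one)
qed (transfer; simp add: fun_eq_iff)+

end

lemma sps_zero_nth [simp]: "sps_nth 0 S = 0"
  and sps_one_nth: "sps_nth 1 S = (if S = {} then 1 else 0)"
  and sps_add_nth [simp]: "sps_nth (f + g) S = sps_nth f S + sps_nth g S"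
  and sps_diff_nth [simp]: "sps_nth (f - g) S = sps_nth f S - sps_nth g S"
  and sps_uminus_nth [simp]: "sps_nth (- f) S = - sps_nth f S"
  and sps_mult_nth: "sps_nth (f * g) S = (\<Sum>T\<in>Pow S. sps_nth f T * sps_nth g (S - T))"
  by (transfer, simp add: subset_convolution_def)+

subsection \<open>Partial derivatives\<close>

text \<open>
  Differentiability is a relation because the Leibniz rule only determines the coefficients of the
  derivative on sets that do not contain the variable.
\<close>

definition sps_has_deriv ::
    "'a \<Rightarrow> ('a, 'b :: comm_ring_1) sps \<Rightarrow> ('a, 'b) sps \<Rightarrow> bool" where
  "sps_has_deriv a f f' \<longleftrightarrow>
    (\<forall>S. finite S \<longrightarrow> a \<notin> S \<longrightarrow> sps_nth f (insert a S) = sps_nth f' S)"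

lemma sps_nth_insert:
  "sps_has_deriv a f f' \<Longrightarrow> finite S \<Longrightarrow> a \<notin> S \<Longrightarrow> sps_nth f (insert a S) = sps_nth f' S"
  by (simp add: sps_has_deriv_def)

lemma sps_has_deriv_cong: "sps_has_deriv a f f' \<Longrightarrow> f' = f'' \<Longrightarrow> sps_has_deriv a f f''"
  by simp

named_theorems sps_has_deriv_intros

lemma sps_has_deriv_one [sps_has_deriv_intros]: "sps_has_deriv a 1 0"
  by (simp add: sps_has_deriv_def sps_one_nth)

lemma sps_has_deriv_add [sps_has_deriv_intros]:
  "sps_has_deriv a f f' \<Longrightarrow> sps_has_deriv a g g' \<Longrightarrow> sps_has_deriv a (f + g) (f' + g')"
  by (simp add: sps_has_deriv_def)

lemma sps_has_deriv_diff [sps_has_deriv_intros]: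
  "sps_has_deriv a f f' \<Longrightarrow> sps_has_deriv a g g' \<Longrightarrow> sps_has_deriv a (f - g) (f' - g')"
  by (simp add: sps_has_deriv_def)

lemma sum_Pow_insert:
  assumes "finite S" "a \<notin> S"
  shows "sum f (Pow (insert a S)) = (\<Sum>T\<in>Pow S. f T) + (\<Sum>T\<in>Pow S. f (insert a T))"
proof -
  have "inj_on (insert a) (Pow S)"
    using assms(2) by (intro inj_onI) (metis PowD insert_ident subsetD)
  moreover have "Pow S \<inter> insert a ` Pow S = {}"
    using assms(2) by auto
  ultimately show ?thesis
    using assms(1) by (simp add: Pow_insert sum.union_disjoint sum.reindex)
qed

lemma sps_has_deriv_mult [sps_has_deriv_intros]:
  assumes "sps_has_deriv a f f'" "sps_has_deriv a g g'"
  shows "sps_has_deriv a (f * g) (f' * g + f * g')"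
  unfolding sps_has_deriv_def
proof (intro allI impI)
  fix S :: "'a set"
  assume S: "finite S" "a \<notin> S"
  have "sps_nth f (insert a T) = sps_nth f' T" if "T \<in> Pow S" for T
    using that S by (intro sps_nth_insert [OF assms(1)]) (auto intro: finite_subset)
  moreover have "sps_nth g (insert a S - T) = sps_nth g' (S - T)" if "T \<in> Pow S" for T
    using that S sps_nth_insert [OF assms(2), of "S - T"]
    by (metis Diff_iff PowD finite_Diff insert_Diff_if subsetD)
  ultimately show "sps_nth (f * g) (insert a S) = sps_nth (f' * g + f * g') S"
    using S by (simp add: sps_mult_nth sum_Pow_insert)
qed

subsection \<open>Renaming and restricting the variables\<close>

lift_definition sps_pullback ::
    "('a \<Rightarrow> 'b) \<Rightarrow> 'a set \<Rightarrow> ('b, 'c :: comm_ring_1) sps \<Rightarrow> ('a, 'c) sps" is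
  "\<lambda>h X f S. if finite S \<and> S \<subseteq> X then f (h ` S) else 0"
  by simp

abbreviation sps_restrict :: "'a set \<Rightarrow> ('a, 'b :: comm_ring_1) sps \<Rightarrow> ('a, 'b) sps" where
  "sps_restrict \<equiv> sps_pullback (\<lambda>x. x)"

lemma sps_pullback_nth:
  "sps_nth (sps_pullback h X f) S = (if finite S \<and> S \<subseteq> X then sps_nth f (h ` S) else 0)"
  by transfer simp

lemma sps_pullback_one [simp]: "sps_pullback h X 1 = 1"
  by (rule sps_ext) (auto simp: sps_pullback_nth sps_one_nth)

lemma sps_pullback_add [simp]: "sps_pullback h X (f + g) = sps_pullback h X f + sps_pullback h X g"
  and sps_pullback_diff [simp]:
    "sps_pullback h X (f - g) = sps_pullback h X f - sps_pullback h X g"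
  by (rule sps_ext; simp add: sps_pullback_nth)+

lemma sps_pullback_mult:
  assumes "inj_on h X"
  shows "sps_pullback h X (f * g) = sps_pullback h X f * sps_pullback h X g"
proof (rule sps_ext)
  fix S :: "'a set"
  assume fin: "finite S"
  show "sps_nth (sps_pullback h X (f * g)) S = sps_nth (sps_pullback h X f * sps_pullback h X g) S"
  proof (cases "S \<subseteq> X")
    case True
    hence inj: "inj_on h S" using assms inj_on_subset by blast
    have "sps_nth (f * g) (h ` S) = (\<Sum>T\<in>Pow S. sps_nth f (h ` T) * sps_nth g (h ` S - h ` T))"
      unfolding sps_mult_nth
      by (subst image_Pow_surj [OF refl, symmetric], subst sum.reindex)
         (simp_all add: inj_on_image_Pow [OF inj])
    also have "\<dots> = (\<Sum>T\<in>Pow S. sps_nth f (h ` T) * sps_nth g (h ` (S - T)))"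
      by (intro sum.cong refl) (simp add: inj_on_image_set_diff [OF inj])
    also have "\<dots> = sps_nth (sps_pullback h X f * sps_pullback h X g) S"
      unfolding sps_mult_nth
    proof (intro sum.cong refl)
      fix T
      assume "T \<in> Pow S"
      hence "finite T" "T \<subseteq> X" "S - T \<subseteq> X"
        using True fin by (auto intro: finite_subset)
      thus "sps_nth f (h ` T) * sps_nth g (h ` (S - T)) =
          sps_nth (sps_pullback h X f) T * sps_nth (sps_pullback h X g) (S - T)"
        using fin by (simp add: sps_pullback_nth)
    qed
    finally show ?thesis using True fin by (simp add: sps_pullback_nth)
  next
    case False
    hence "sps_nth (sps_pullback h X f) T * sps_nth (sps_pullback h X g) (S - T) = 0" for T
      by (auto simp: sps_pullback_nth)
    hence "sps_nth (sps_pullback h X f * sps_pullback h X g) S = 0"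
      unfolding sps_mult_nth by (intro sum.neutral ballI)
    thus ?thesis using False by (simp add: sps_pullback_nth)
  qed
qed

lemma sps_nth_image_eqI:
  assumes "finite X" "sps_pullback h X f = sps_restrict X g"
  shows "sps_nth f (h ` X) = sps_nth g X"
  using arg_cong [OF assms(2), of "\<lambda>f. sps_nth f X"] assms(1) by (simp add: sps_pullback_nth)

lemma sps_nth_eqI:
  "finite X \<Longrightarrow> sps_restrict X f = sps_restrict X g \<Longrightarrow> sps_nth f X = sps_nth g X"
  using sps_nth_image_eqI [of X "\<lambda>x. x"] by simp

section \<open>Exponential generating functions on a set of variables\<close>

lift_definition egf :: "'b :: field_char_0 fps \<Rightarrow> 'a set \<Rightarrow> ('a, 'b) sps" is
  "\<lambda>A X S. if finite S \<and> S \<subseteq> X then fact (card S) * fps_nth A (card S) else 0"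
  by simp

lemma egf_nth:
  "sps_nth (egf A X) S = (if finite S \<and> S \<subseteq> X then fact (card S) * fps_nth A (card S) else 0)"
  by transfer simp

lemma egf_one [simp]: "egf 1 X = 1"
  by (rule sps_ext) (auto simp: egf_nth sps_one_nth)

lemma egf_add: "egf (A + B) X = egf A X + egf B X"
  and egf_diff: "egf (A - B) X = egf A X - egf B X"
  and egf_uminus: "egf (- A) X = - egf A X"
  by (rule sps_ext; simp add: egf_nth algebra_simps)+

lemma egf_empty_eq_one: "fps_nth A 0 = 1 \<Longrightarrow> egf A {} = 1"
  and egf_empty_eq_zero: "fps_nth A 0 = 0 \<Longrightarrow> egf A {} = 0"
  by (rule sps_ext; simp add: egf_nth sps_one_nth)+

lemma egf_has_deriv: "sps_has_deriv a (egf A X) (if a \<in> X then egf (fps_deriv A) X else 0)"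
  by (auto simp: sps_has_deriv_def egf_nth)

lemma egf_mult: "egf (A * B) X = egf A X * egf B X"
proof (rule sps_ext)
  fix S :: "'a set"
  assume "finite S"
  thus "sps_nth (egf (A * B) X) S = sps_nth (egf A X * egf B X) S"
  proof (induction S arbitrary: A B)
    case empty
    show ?case by (simp add: egf_nth sps_mult_nth)
  next
    case (insert a S)
    have "sps_has_deriv a (egf A X * egf B X) (if a \<in> X
        then egf (fps_deriv A) X * egf B X + egf A X * egf (fps_deriv B) X else 0)"
      by (rule sps_has_deriv_cong, (rule sps_has_deriv_mult egf_has_deriv)+) simp
    hence "sps_nth (egf A X * egf B X) (insert a S) =
        sps_nth (if a \<in> X then egf (fps_deriv (A * B)) X else 0) S"
      using insert.hyps by (simp add: sps_nth_insert insert.IH egf_add)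
    also have "\<dots> = sps_nth (egf (A * B) X) (insert a S)"
      using insert.hyps by (intro sps_nth_insert [symmetric] egf_has_deriv)
    finally show ?case ..
  qed
qed

lemma sps_pullback_egf:
  assumes "inj_on h X"
  shows "sps_pullback h X (egf A Y) = egf A (X \<inter> h -` Y)"
proof (rule sps_ext)
  fix S :: "'a set"
  assume "finite S"
  moreover have "card (h ` S) = card S" if "S \<subseteq> X"
    using that assms inj_on_subset by (blast intro: card_image)
  ultimately show "sps_nth (sps_pullback h X (egf A Y)) S = sps_nth (egf A (X \<inter> h -` Y)) S"
    by (auto simp: sps_pullback_nth egf_nth)
qed

section \<open>Tangent, secant and trigonometric identities\<close>

definition fps_tan_sec :: "'a :: field_char_0 fps" where
  "fps_tan_sec = fps_tan 1 + inverse (fps_cos 1)"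

lemma fps_sin_deriv_1: "fps_deriv (fps_sin 1) = fps_cos (1 :: 'a :: field_char_0)"
  by (simp add: fps_sin_deriv)

lemma fps_cos_deriv_1: "fps_deriv (fps_cos 1) = - fps_sin (1 :: 'a :: field_char_0)"
  by (simp add: fps_cos_deriv flip: fps_const_neg)

lemma fps_eq_if_mult_cos_eq:
  fixes A B :: "'a :: field_char_0 fps"
  assumes "A * fps_cos c = B * fps_cos c"
  shows "A = B"
proof -
  have "fps_cos c \<noteq> 0" by (metis fps_cos_nth_0 fps_zero_nth zero_neq_one)
  thus ?thesis using assms by simp
qed

lemma fps_tan_sec_mult_cos: "fps_tan_sec * fps_cos 1 = 1 + fps_sin (1 :: 'a :: field_char_0)"
proof -
  have "fps_cos (1 :: 'a) dvd fps_sin 1"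
    by (rule dvd_trans [OF _ one_dvd]) (simp add: fps_is_unit_iff)
  hence "fps_tan 1 * fps_cos 1 = fps_sin (1 :: 'a)"
    unfolding fps_tan_def by (rule dvd_div_mult_self)
  moreover have "inverse (fps_cos 1) * fps_cos 1 = (1 :: 'a fps)"
    by (intro inverse_mult_eq_1) simp
  ultimately show ?thesis by (simp add: fps_tan_sec_def distrib_right add.commute)
qed

lemma fps_tan_sec_mult_sin:
  "fps_tan_sec * fps_sin 1 = fps_tan_sec - fps_cos (1 :: 'a :: field_char_0)"
proof (rule fps_eq_if_mult_cos_eq)
  show "fps_tan_sec * fps_sin 1 * fps_cos 1 = (fps_tan_sec - fps_cos 1) * fps_cos (1 :: 'a)"
    using fps_tan_sec_mult_cos [where 'a = 'a] fps_sin_cos_sum_of_squares [of "1 :: 'a"] by algebra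
qed

lemma fps_deriv_tan_sec_mult_cos:
  "fps_deriv fps_tan_sec * fps_cos 1 = (fps_tan_sec :: 'a :: field_char_0 fps)"
proof -
  have "fps_deriv (fps_tan_sec * fps_cos 1) = fps_deriv (1 + fps_sin (1 :: 'a))"
    by (simp only: fps_tan_sec_mult_cos)
  hence "fps_deriv fps_tan_sec * fps_cos 1 - fps_tan_sec * fps_sin 1 = fps_cos (1 :: 'a)"
    by (simp add: fps_sin_deriv_1 fps_cos_deriv_1)
  thus ?thesis by (simp add: fps_tan_sec_mult_sin)
qed

lemma fps_deriv_tan_sec_mult_sin:
  "fps_deriv fps_tan_sec * fps_sin 1 = fps_deriv fps_tan_sec - (1 :: 'a :: field_char_0 fps)"
proof (rule fps_eq_if_mult_cos_eq)
  have "fps_deriv fps_tan_sec * fps_sin 1 * fps_cos 1 =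
      fps_deriv fps_tan_sec * fps_cos 1 * fps_sin (1 :: 'a)"
    by (simp only: mult_ac)
  thus "fps_deriv fps_tan_sec * fps_sin 1 * fps_cos 1 =
      (fps_deriv fps_tan_sec - 1) * fps_cos (1 :: 'a)"
    by (simp add: left_diff_distrib fps_deriv_tan_sec_mult_cos fps_tan_sec_mult_sin)
qed

lemma fps_tan_sec_square:
  "(fps_tan_sec :: 'a :: field_char_0 fps)\<^sup>2 = 2 * fps_deriv fps_tan_sec - 1"
proof (rule fps_eq_if_mult_cos_eq)
  show "fps_tan_sec\<^sup>2 * fps_cos 1 = (2 * fps_deriv fps_tan_sec - 1) * fps_cos (1 :: 'a)"
    by (simp add: power2_eq_square mult.assoc left_diff_distrib distrib_left
        fps_deriv_tan_sec_mult_cos fps_tan_sec_mult_cos fps_tan_sec_mult_sin)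
qed

lemma fps_deriv_deriv_tan_sec:
  "fps_deriv (fps_deriv fps_tan_sec) =
    fps_tan_sec * fps_deriv (fps_tan_sec :: 'a :: field_char_0 fps)"
proof -
  have "fps_deriv (fps_tan_sec\<^sup>2) = fps_deriv (2 * fps_deriv fps_tan_sec - (1 :: 'a fps))"
    by (simp only: fps_tan_sec_square)
  hence "2 * fps_deriv (fps_deriv fps_tan_sec) =
      2 * (fps_tan_sec * fps_deriv (fps_tan_sec :: 'a fps))"
    by (simp add: power2_eq_square algebra_simps)
  thus ?thesis by simp
qed

lemma fps_tan_sec_nth_0: "fps_nth (fps_tan_sec :: 'a :: field_char_0 fps) 0 = 1"
  using arg_cong [OF fps_tan_sec_mult_cos [where 'a = 'a], of "\<lambda>A. fps_nth A 0"] by simp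

lemma fps_deriv_tan_sec_nth_0: "fps_nth (fps_deriv (fps_tan_sec :: 'a :: field_char_0 fps)) 0 = 1"
  using arg_cong [OF fps_deriv_tan_sec_mult_cos [where 'a = 'a], of "\<lambda>A. fps_nth A 0"]
  by (simp add: fps_tan_sec_nth_0 del: fps_deriv_nth)

abbreviation Cos :: "'a set \<Rightarrow> ('a, 'b :: field_char_0) sps" where "Cos \<equiv> egf (fps_cos 1)"
abbreviation Sin :: "'a set \<Rightarrow> ('a, 'b :: field_char_0) sps" where "Sin \<equiv> egf (fps_sin 1)"
abbreviation Euler :: "('a, 'b :: field_char_0) sps" where "Euler \<equiv> egf fps_tan_sec UNIV"
abbreviation Euler' :: "('a, 'b :: field_char_0) sps" where
  "Euler' \<equiv> egf (fps_deriv fps_tan_sec) UNIV"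

lemma Cos_empty [simp]: "Cos {} = 1" and Sin_empty [simp]: "Sin {} = 0"
  by (simp_all add: egf_empty_eq_one egf_empty_eq_zero)

lemma Euler_has_deriv [sps_has_deriv_intros]: "sps_has_deriv a Euler Euler'"
  using egf_has_deriv [of a fps_tan_sec UNIV] by simp

lemma Euler'_has_deriv [sps_has_deriv_intros]: "sps_has_deriv a Euler' (Euler * Euler')"
  using egf_has_deriv [of a "fps_deriv fps_tan_sec" UNIV]
  by (simp add: fps_deriv_deriv_tan_sec egf_mult)

lemma Euler_nth_insert_insert:
  assumes "finite S" "b \<notin> S" "a \<notin> insert b S"
  shows "sps_nth Euler (insert a (insert b S)) = sps_nth (Euler * Euler') S"
  using assms
  by (simp add: sps_nth_insert [OF Euler_has_deriv] sps_nth_insert [OF Euler'_has_deriv])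

lemma Cos_has_deriv [sps_has_deriv_intros]:
  "sps_has_deriv a (Cos X) (if a \<in> X then - Sin X else 0)"
  using egf_has_deriv [of a "fps_cos 1" X]
  by (cases "a \<in> X") (simp_all add: fps_cos_deriv_1 egf_uminus)

lemma Sin_has_deriv [sps_has_deriv_intros]:
  "sps_has_deriv a (Sin X) (if a \<in> X then Cos X else 0)"
  using egf_has_deriv [of a "fps_sin 1" X]
  by (cases "a \<in> X") (simp_all add: fps_sin_deriv_1)

lemma Cos_square_add_Sin_square: "(Cos X)\<^sup>2 + (Sin X)\<^sup>2 = (1 :: ('a, 'b :: field_char_0) sps)"
  using arg_cong [OF fps_sin_cos_sum_of_squares [of "1 :: 'b"], of "\<lambda>A. egf A X"]
  by (simp add: power2_eq_square egf_add egf_mult)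

lemma Euler_mult_Cos: "Euler * Cos UNIV = 1 + Sin UNIV"
  by (simp add: fps_tan_sec_mult_cos egf_add flip: egf_mult)

lemma Euler_mult_Sin: "Euler * Sin UNIV = Euler - Cos UNIV"
  by (simp add: fps_tan_sec_mult_sin egf_diff flip: egf_mult)

lemma Euler'_mult_Cos: "Euler' * Cos UNIV = Euler"
  by (simp add: fps_deriv_tan_sec_mult_cos flip: egf_mult)

lemma Euler'_mult_Sin: "Euler' * Sin UNIV = Euler' - 1"
  by (simp add: fps_deriv_tan_sec_mult_sin egf_diff flip: egf_mult)

lemma Euler_square: "Euler\<^sup>2 = 2 * Euler' - (1 :: ('a, 'b :: field_char_0) sps)"
  using arg_cong [OF fps_tan_sec_square [where 'a = 'b], of "\<lambda>A. egf A (UNIV :: 'a set)"]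
  by (simp only: power2_eq_square mult_2 egf_mult egf_diff egf_add egf_one)

lemma Cos_Sin_Un_nth:
  assumes "finite S" "X \<inter> Y = {}"
  shows "sps_nth (Cos (X \<union> Y)) S =
      (sps_nth (Cos X * Cos Y - Sin X * Sin Y) S :: 'b :: field_char_0) \<and>
    sps_nth (Sin (X \<union> Y)) S = (sps_nth (Sin X * Cos Y + Cos X * Sin Y) S :: 'b)"
  using assms(1)
proof (induction S)
  case empty
  show ?case by (simp add: egf_nth sps_mult_nth)
next
  case (insert a S)
  let ?C = "Cos X * Cos Y - Sin X * Sin Y" and ?S = "Sin X * Cos Y + Cos X * Sin Y"
  have Cos_deriv: "sps_has_deriv a ?C (if a \<in> X \<union> Y then - ?S else 0)"
    by (rule sps_has_deriv_cong, (rule sps_has_deriv_intros)+)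
       (use assms(2) in \<open>auto simp: algebra_simps\<close>)
  have Sin_deriv: "sps_has_deriv a ?S (if a \<in> X \<union> Y then ?C else 0)"
    by (rule sps_has_deriv_cong, (rule sps_has_deriv_intros)+)
       (use assms(2) in \<open>auto simp: algebra_simps\<close>)
  show ?case
    unfolding sps_nth_insert [OF Cos_has_deriv insert.hyps]
      sps_nth_insert [OF Sin_has_deriv insert.hyps]
      sps_nth_insert [OF Cos_deriv insert.hyps] sps_nth_insert [OF Sin_deriv insert.hyps]
    using insert.IH by simp
qed

lemma Cos_Un: "X \<inter> Y = {} \<Longrightarrow> Cos (X \<union> Y) = Cos X * Cos Y - Sin X * Sin Y"
  and Sin_Un: "X \<inter> Y = {} \<Longrightarrow> Sin (X \<union> Y) = Sin X * Cos Y + Cos X * Sin Y"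
  by (rule sps_ext, metis Cos_Sin_Un_nth)+

lemma Cos_Compl: "Cos (- X) = Cos UNIV * Cos X + Sin UNIV * Sin X"
proof -
  have "Cos (X \<union> - X) * Cos X + Sin (X \<union> - X) * Sin X = Cos (- X) * ((Cos X)\<^sup>2 + (Sin X)\<^sup>2)"
    by (simp only: Cos_Un Sin_Un Compl_disjoint) (simp add: algebra_simps power2_eq_square)
  thus ?thesis by (simp add: Cos_square_add_Sin_square eq_commute)
qed

lemma Sin_Compl: "Sin (- X) = Sin UNIV * Cos X - Cos UNIV * Sin X"
proof -
  have "Sin (X \<union> - X) * Cos X - Cos (X \<union> - X) * Sin X = Sin (- X) * ((Cos X)\<^sup>2 + (Sin X)\<^sup>2)"
    by (simp only: Cos_Un Sin_Un Compl_disjoint) (simp add: algebra_simps power2_eq_square)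
  thus ?thesis by (simp add: Cos_square_add_Sin_square eq_commute)
qed

section \<open>The generating functions of the first and next-to-last letter\<close>

definition first_gf :: "'a set \<Rightarrow> ('a, 'b :: field_char_0) sps" where
  "first_gf Z = Cos Z + Euler * Sin Z"

definition next_to_last_gf :: "'a set \<Rightarrow> ('a, 'b :: field_char_0) sps" where
  "next_to_last_gf Z = Euler' * Cos Z"

definition joint_less_gf :: "'a set \<Rightarrow> 'a set \<Rightarrow> ('a, 'b :: field_char_0) sps" where
  "joint_less_gf X Z = Euler' * Cos X * Cos Z"

definition joint_greater_gf :: "'a set \<Rightarrow> 'a set \<Rightarrow> ('a, 'b :: field_char_0) sps" where
  "joint_greater_gf X Z = Cos X * Cos Z + Euler * (Sin X * Cos Z + Cos X * Sin Z) +
    (Euler' - 1) * (Sin X * Sin Z)"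

lemma joint_less_gf_commute: "joint_less_gf X Z = joint_less_gf Z X"
  by (simp add: joint_less_gf_def ac_simps)

lemma joint_greater_gf_commute: "joint_greater_gf X Z = joint_greater_gf Z X"
  by (simp add: joint_greater_gf_def ac_simps)

lemma first_gf_UNIV [simp]: "first_gf UNIV = Euler"
  by (simp add: first_gf_def Euler_mult_Sin)

lemma next_to_last_gf_UNIV [simp]: "next_to_last_gf UNIV = Euler"
  by (simp add: next_to_last_gf_def Euler'_mult_Cos)

lemma first_gf_empty [simp]: "first_gf {} = 1"
  by (simp add: first_gf_def)

lemma joint_less_gf_empty [simp]: "joint_less_gf {} Z = next_to_last_gf Z"
  by (simp add: joint_less_gf_def next_to_last_gf_def)

lemma joint_greater_gf_empty [simp]: "joint_greater_gf {} Z = first_gf Z"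
  by (simp add: joint_greater_gf_def first_gf_def)

lemma first_gf_Compl: "first_gf (- X) = Euler * Cos X - Sin X"
proof -
  have "first_gf (- X) = Cos UNIV * Cos X + Sin UNIV * Sin X +
      (Euler * Sin UNIV) * Cos X - (Euler * Cos UNIV) * Sin X"
    by (simp add: first_gf_def Cos_Compl Sin_Compl algebra_simps)
  also have "\<dots> = Euler * Cos X - Sin X"
    by (simp add: Euler_mult_Sin Euler_mult_Cos algebra_simps)
  finally show ?thesis .
qed

lemma next_to_last_gf_Compl: "next_to_last_gf (- X) = Euler * Cos X + (Euler' - 1) * Sin X"
proof -
  have "next_to_last_gf (- X) = (Euler' * Cos UNIV) * Cos X + (Euler' * Sin UNIV) * Sin X"
    by (simp add: next_to_last_gf_def Cos_Compl algebra_simps)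
  thus ?thesis by (simp only: Euler'_mult_Cos Euler'_mult_Sin)
qed

lemma first_gf_has_deriv_in:
  "a \<in> Z \<Longrightarrow> sps_has_deriv a (first_gf Z) (Euler' * Sin Z + first_gf (- Z))"
  unfolding first_gf_Compl unfolding first_gf_def
  by (rule sps_has_deriv_cong, (rule sps_has_deriv_intros)+) (simp add: algebra_simps)

lemma first_gf_has_deriv_notin: "a \<notin> Z \<Longrightarrow> sps_has_deriv a (first_gf Z) (Euler' * Sin Z)"
  unfolding first_gf_def
  by (rule sps_has_deriv_cong, (rule sps_has_deriv_intros)+) simp

lemma Euler'_mult_Sin_has_deriv:
  "a \<in> Z \<Longrightarrow> sps_has_deriv a (Euler' * Sin Z) (first_gf Z * Euler')"
  unfolding first_gf_def
  by (rule sps_has_deriv_cong, (rule sps_has_deriv_intros)+) (simp add: algebra_simps)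

lemma first_gf_nth_insert_insert:
  assumes "finite S" "b \<notin> S" "a \<notin> insert b S" "a \<notin> Z" "b \<in> Z"
  shows "sps_nth (first_gf Z) (insert a (insert b S)) = sps_nth (first_gf Z * Euler') S"
  using assms
  by (simp add: sps_nth_insert [OF first_gf_has_deriv_notin]
      sps_nth_insert [OF Euler'_mult_Sin_has_deriv])

lemma next_to_last_gf_has_deriv:
  "a \<notin> Z \<Longrightarrow> sps_has_deriv a (next_to_last_gf Z) (Euler * next_to_last_gf Z)"
  unfolding next_to_last_gf_def
  by (rule sps_has_deriv_cong, (rule sps_has_deriv_intros)+) (simp add: algebra_simps)

lemma joint_less_gf_has_deriv:
  assumes "a \<in> X" "a \<notin> Z"
  shows "sps_has_deriv a (joint_less_gf X Z) (first_gf (- X) * next_to_last_gf Z)"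
  unfolding joint_less_gf_def first_gf_Compl next_to_last_gf_def
  by (rule sps_has_deriv_cong, (rule sps_has_deriv_intros)+)
     (use assms in \<open>simp add: algebra_simps\<close>)

lemma joint_greater_gf_has_deriv:
  assumes "a \<in> X" "a \<notin> Z"
  shows "sps_has_deriv a (joint_greater_gf X Z) (first_gf Z * next_to_last_gf (- X))"
proof -
  have "first_gf Z * next_to_last_gf (- X) = Cos Z * (Euler * Cos X + (Euler' - 1) * Sin X) +
      Sin Z * (Euler\<^sup>2 * Cos X + (Euler * Euler' - Euler) * Sin X)"
    unfolding first_gf_def next_to_last_gf_Compl by (simp add: algebra_simps power2_eq_square)
  hence prod: "first_gf Z * next_to_last_gf (- X) =
      Cos Z * (Euler * Cos X + (Euler' - 1) * Sin X) +
      Sin Z * ((Euler' + Euler' - 1) * Cos X + (Euler * Euler' - Euler) * Sin X)"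
    by (simp only: Euler_square mult_2)
  show ?thesis
    unfolding prod joint_greater_gf_def
    by (rule sps_has_deriv_cong, (rule sps_has_deriv_intros)+)
       (use assms in \<open>simp add: algebra_simps\<close>)
qed

context
  fixes h :: "'a \<Rightarrow> 'c" and S :: "'a set"
  assumes finite_S: "finite S" and inj: "inj_on h S"
begin

lemma first_gf_nth_image:
  assumes "S \<inter> h -` Z = S \<inter> Z'"
  shows "sps_nth (first_gf Z) (h ` S) = sps_nth (first_gf Z') S"
  using finite_S inj assms
  by (intro sps_nth_image_eqI) (simp_all add: first_gf_def sps_pullback_mult sps_pullback_egf)

lemma joint_less_gf_nth_image:
  assumes "S \<inter> h -` X = S \<inter> X'" "S \<inter> h -` Z = S \<inter> Z'"
  shows "sps_nth (joint_less_gf X Z) (h ` S) = sps_nth (joint_less_gf X' Z') S"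
  using finite_S inj assms
  by (intro sps_nth_image_eqI) (simp_all add: joint_less_gf_def sps_pullback_mult sps_pullback_egf)

lemma joint_greater_gf_nth_image:
  assumes "S \<inter> h -` X = S \<inter> X'" "S \<inter> h -` Z = S \<inter> Z'"
  shows "sps_nth (joint_greater_gf X Z) (h ` S) = sps_nth (joint_greater_gf X' Z') S"
  using finite_S inj assms
  by (intro sps_nth_image_eqI)
     (simp_all add: joint_greater_gf_def sps_pullback_mult sps_pullback_egf)

end

lemma first_gf_nth_cong:
  "finite S \<Longrightarrow> S \<inter> Z = S \<inter> Z' \<Longrightarrow> sps_nth (first_gf Z) S = sps_nth (first_gf Z') S"
  using first_gf_nth_image [of S "\<lambda>x. x"] by simp

lemma next_to_last_gf_nth_cong:
  "finite S \<Longrightarrow> S \<inter> Z = S \<inter> Z' \<Longrightarrow>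
    sps_nth (next_to_last_gf Z) S = sps_nth (next_to_last_gf Z') S"
  by (rule sps_nth_eqI) (simp_all add: next_to_last_gf_def sps_pullback_mult sps_pullback_egf)

lemma joint_less_gf_nth_cong:
  "finite S \<Longrightarrow> S \<inter> X = S \<inter> X' \<Longrightarrow>
    sps_nth (joint_less_gf X Z) S = sps_nth (joint_less_gf X' Z) S"
  using joint_less_gf_nth_image [of S "\<lambda>x. x" X X' Z Z] by simp

lemma joint_greater_gf_nth_cong:
  "finite S \<Longrightarrow> S \<inter> X = S \<inter> X' \<Longrightarrow>
    sps_nth (joint_greater_gf X Z) S = sps_nth (joint_greater_gf X' Z) S"
  using joint_greater_gf_nth_image [of S "\<lambda>x. x" X X' Z Z] by simp

section \<open>Cutting Andre words at their minimum\<close>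

definition andre_words :: "nat set \<Rightarrow> nat list set" where
  "andre_words Y = {w \<in> permutations_of_set Y. andre_I w}"

definition andre_count :: "(nat list \<Rightarrow> bool) \<Rightarrow> nat set \<Rightarrow> nat" where
  "andre_count R Y = card {w \<in> andre_words Y. R w}"

lemma andre_words_iff: "w \<in> andre_words Y \<longleftrightarrow> distinct w \<and> set w = Y \<and> andre_I w"
  by (auto simp: andre_words_def permutations_of_set_def)

lemma finite_andre_words [simp]: "finite (andre_words Y)"
  by (simp add: andre_words_def)

lemma andre_words_empty: "andre_words {} = {[]}"
  by (auto simp: andre_words_iff intro: andre_I.intros)

lemma andre_words_singleton: "0 < x \<Longrightarrow> andre_words {x} = {[x]}"
  by (auto simp: andre_words_def intro: andre_I.singleton)

lemma andre_count_eq_Nil: "real (andre_count (\<lambda>w. w = []) Y) = sps_nth 1 Y"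
proof -
  have "{w \<in> andre_words Y. w = []} = (if Y = {} then {[]} else {})"
    by (auto simp: andre_words_iff intro: andre_I.Nil)
  thus ?thesis by (simp add: andre_count_def sps_one_nth)
qed

lemma andre_count_eq_singleton:
  assumes "0 < M" "M \<notin> Y"
  shows "real (andre_count (\<lambda>w. w = [M]) (insert M Y)) = sps_nth 1 Y"
proof -
  have "{w \<in> andre_words (insert M Y). w = [M]} = (if Y = {} then {[M]} else {})"
    using assms by (auto simp: andre_words_iff intro: andre_I.singleton)
  thus ?thesis by (simp add: andre_count_def sps_one_nth)
qed

lemma andre_I_append_Cons_iff:
  assumes "distinct (v @ x # v')" "x = Min (set (v @ x # v'))" "v @ v' \<noteq> []"
  shows "andre_I (v @ x # v') \<longleftrightarrow>
    0 < x \<and> andre_I v \<and> andre_I v' \<and> Max (set (v @ v')) \<in> set v'"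
proof
  assume "andre_I (v @ x # v')"
  thus "0 < x \<and> andre_I v \<and> andre_I v' \<and> Max (set (v @ v')) \<in> set v'"
  proof cases
    case (split u u' y)
    have "y = x" using split(1,5) assms(2) by simp
    moreover have "x \<notin> set v" "x \<notin> set v'" using assms(1) by auto
    ultimately have "y = x" "u = v" "u' = v'"
      using split(1) append_Cons_eq_iff [of x v v' u u'] by auto
    thus ?thesis using split by simp
  qed (use assms(3) in \<open>auto simp: append_eq_Cons_conv\<close>)
next
  assume "0 < x \<and> andre_I v \<and> andre_I v' \<and> Max (set (v @ v')) \<in> set v'"
  thus "andre_I (v @ x # v')"
    using assms by (intro andre_I.split) auto
qed

lemma append_Cons_in_andre_words_iff:
  assumes "0 < x" "x < M" "Y \<subseteq> {x<..<M}"
  shows "v @ x # v' \<in> andre_words (insert x (insert M Y)) \<longleftrightarrow>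
    (\<exists>T\<subseteq>Y. v \<in> andre_words T \<and> v' \<in> andre_words (insert M (Y - T)))"
proof -
  have notin: "x \<notin> insert M Y" "M \<notin> Y" using assms by auto
  have fin: "finite Y" using assms(3) finite_subset by blast
  have Min: "Min (insert x (insert M Y)) = x"
    using assms fin by (intro Min_eqI) (auto dest: less_imp_le)
  have Max: "Max (insert M Y) = M"
    using assms fin by (intro Max_eqI) (auto dest: less_imp_le)
  have "v @ x # v' \<in> andre_words (insert x (insert M Y)) \<longleftrightarrow>
      distinct (v @ x # v') \<and> set v \<union> set v' = insert M Y \<and> andre_I v \<and> andre_I v' \<and> M \<in> set v'"
  proof (cases "distinct (v @ x # v') \<and> set v \<union> set v' = insert M Y")
    case True
    hence "andre_I (v @ x # v') \<longleftrightarrow> andre_I v \<and> andre_I v' \<and> M \<in> set v'"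
      using Min Max assms(1) by (subst andre_I_append_Cons_iff) auto
    thus ?thesis using True by (auto simp: andre_words_iff)
  next
    case False
    thus ?thesis using notin(1) by (auto simp: andre_words_iff)
  qed
  also have "\<dots> \<longleftrightarrow> (\<exists>T\<subseteq>Y. v \<in> andre_words T \<and> v' \<in> andre_words (insert M (Y - T)))"
  proof (intro iffI; (elim exE)?)
    assume decomp: "distinct (v @ x # v') \<and> set v \<union> set v' = insert M Y \<and> andre_I v \<and> andre_I v' \<and>
      M \<in> set v'"
    hence "set v \<subseteq> Y \<and> set v' = insert M (Y - set v)" using notin(2) by auto
    thus "\<exists>T\<subseteq>Y. v \<in> andre_words T \<and> v' \<in> andre_words (insert M (Y - T))"
      using decomp by (auto simp: andre_words_iff)
  qed (use notin in \<open>auto simp: andre_words_iff\<close>)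
  finally show ?thesis .
qed

text \<open>
  The letters \<open>P\<close> and \<open>Q\<close> are prescribed to lie to the left and to the right of the minimum; the
  remaining letters \<open>S\<close> are the variables of the generating functions.
\<close>

context
  fixes x M :: nat and P Q S Y :: "nat set" and R R\<^sub>1 R\<^sub>2 :: "nat list \<Rightarrow> bool"
  assumes x_bounds: "0 < x" "x < M"
    and labels: "P \<union> Q \<union> S \<subseteq> {x<..<M}" "P \<inter> Q = {}" "(P \<union> Q) \<inter> S = {}"
    and Y_eq: "Y = insert x (insert M (P \<union> Q \<union> S))"
    and R_append_Cons: "\<And>v v'. distinct (v @ x # v') \<Longrightarrow> set v \<union> set v' = insert M (P \<union> Q \<union> S) \<Longrightarrow>
      M \<in> set v' \<Longrightarrow> R (v @ x # v') \<longleftrightarrow> P \<subseteq> set v \<and> Q \<subseteq> set v' \<and> R\<^sub>1 v \<and> R\<^sub>2 v'"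
begin

lemma append_Cons_in_andre_words_prescribed_iff:
  "v @ x # v' \<in> andre_words Y \<and> R (v @ x # v') \<longleftrightarrow>
    (\<exists>T\<subseteq>S. v \<in> andre_words (P \<union> T) \<and> R\<^sub>1 v \<and> v' \<in> andre_words (insert M (Q \<union> (S - T))) \<and> R\<^sub>2 v')"
proof -
  have "M \<notin> P \<union> Q \<union> S" using labels(1) by auto
  have "v @ x # v' \<in> andre_words Y \<and> R (v @ x # v') \<longleftrightarrow>
      v @ x # v' \<in> andre_words Y \<and> P \<subseteq> set v \<and> Q \<subseteq> set v' \<and> R\<^sub>1 v \<and> R\<^sub>2 v'"
  proof (rule conj_cong [OF refl])
    assume "v @ x # v' \<in> andre_words Y"
    moreover from this have "M \<in> set v'"
      unfolding Y_eq append_Cons_in_andre_words_iff [OF x_bounds labels(1)]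
      by (auto simp: andre_words_iff)
    moreover have "x \<notin> insert M (P \<union> Q \<union> S)" using x_bounds labels(1) by auto
    ultimately show "R (v @ x # v') \<longleftrightarrow> P \<subseteq> set v \<and> Q \<subseteq> set v' \<and> R\<^sub>1 v \<and> R\<^sub>2 v'"
      by (intro R_append_Cons) (auto simp: andre_words_iff Y_eq)
  qed
  also have "\<dots> \<longleftrightarrow> (\<exists>U\<subseteq>P \<union> Q \<union> S. P \<subseteq> U \<and> Q \<inter> U = {} \<and>
      v \<in> andre_words U \<and> R\<^sub>1 v \<and> v' \<in> andre_words (insert M (P \<union> Q \<union> S - U)) \<and> R\<^sub>2 v')"
    unfolding Y_eq append_Cons_in_andre_words_iff [OF x_bounds labels(1)]
    using \<open>M \<notin> P \<union> Q \<union> S\<close> by (auto simp: andre_words_iff)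
  also have "\<dots> \<longleftrightarrow> (\<exists>T\<subseteq>S. v \<in> andre_words (P \<union> T) \<and> R\<^sub>1 v \<and>
      v' \<in> andre_words (insert M (Q \<union> (S - T))) \<and> R\<^sub>2 v')"
  proof (intro iffI; elim exE conjE)
    fix U
    assume U: "U \<subseteq> P \<union> Q \<union> S" "P \<subseteq> U" "Q \<inter> U = {}" and v: "v \<in> andre_words U" "R\<^sub>1 v"
      "v' \<in> andre_words (insert M (P \<union> Q \<union> S - U))" "R\<^sub>2 v'"
    have "P \<union> (U - P) = U" "Q \<union> (S - (U - P)) = P \<union> Q \<union> S - U" using U labels by auto
    thus "\<exists>T\<subseteq>S. v \<in> andre_words (P \<union> T) \<and> R\<^sub>1 v \<and>
        v' \<in> andre_words (insert M (Q \<union> (S - T))) \<and> R\<^sub>2 v'"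
      using U v by (intro exI [of _ "U - P"]) auto
  next
    fix T
    assume T: "T \<subseteq> S" and v: "v \<in> andre_words (P \<union> T)" "R\<^sub>1 v"
      "v' \<in> andre_words (insert M (Q \<union> (S - T)))" "R\<^sub>2 v'"
    have "Q \<union> (S - T) = P \<union> Q \<union> S - (P \<union> T)" "Q \<inter> (P \<union> T) = {}" using T labels by auto
    thus "\<exists>U\<subseteq>P \<union> Q \<union> S. P \<subseteq> U \<and> Q \<inter> U = {} \<and> v \<in> andre_words U \<and> R\<^sub>1 v \<and>
        v' \<in> andre_words (insert M (P \<union> Q \<union> S - U)) \<and> R\<^sub>2 v'"
      using T v by (intro exI [of _ "P \<union> T"]) auto
  qed
  finally show ?thesis .
qed

lemma andre_words_eq_image:
  "{w \<in> andre_words Y. R w} = (\<lambda>(v, v'). v @ x # v') `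
    (\<Union>T\<in>Pow S. {v \<in> andre_words (P \<union> T). R\<^sub>1 v} \<times>
      {v' \<in> andre_words (insert M (Q \<union> (S - T))). R\<^sub>2 v'})" (is "_ = ?cut ` ?D")
proof (intro equalityI subsetI)
  fix w
  assume w: "w \<in> {w \<in> andre_words Y. R w}"
  hence "x \<in> set w" by (simp add: andre_words_iff Y_eq)
  then obtain v v' where w_eq: "w = v @ x # v'" by (metis in_set_conv_decomp)
  with w w_eq have "(v, v') \<in> ?D"
    using append_Cons_in_andre_words_prescribed_iff [of v v'] by auto
  thus "w \<in> ?cut ` ?D" unfolding w_eq by (rule rev_image_eqI) simp
next
  fix w
  assume "w \<in> ?cut ` ?D"
  thus "w \<in> {w \<in> andre_words Y. R w}"
    using append_Cons_in_andre_words_prescribed_iff by auto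
qed

lemma andre_count_eq_sum:
  "andre_count R Y =
    (\<Sum>T\<in>Pow S. andre_count R\<^sub>1 (P \<union> T) * andre_count R\<^sub>2 (insert M (Q \<union> (S - T))))"
proof -
  let ?A = "\<lambda>T. {v \<in> andre_words (P \<union> T). R\<^sub>1 v}"
    and ?B = "\<lambda>T. {v' \<in> andre_words (insert M (Q \<union> (S - T))). R\<^sub>2 v'}"
  have "inj_on (\<lambda>(v, v'). v @ x # v') (\<Union>T\<in>Pow S. ?A T \<times> ?B T)"
  proof (rule inj_on_subset)
    show "inj_on (\<lambda>(v, v'). v @ x # v') {(v, v'). x \<notin> set v \<and> x \<notin> set v'}"
      by (auto simp: inj_on_def append_Cons_eq_iff)
  qed (use labels(1) x_bounds in \<open>auto simp: andre_words_iff subset_eq\<close>)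
  hence "andre_count R Y = card (\<Union>T\<in>Pow S. ?A T \<times> ?B T)"
    unfolding andre_count_def andre_words_eq_image by (rule card_image)
  also have "\<dots> = (\<Sum>T\<in>Pow S. card (?A T \<times> ?B T))"
  proof (intro card_UN_disjoint ballI impI)
    show "finite (Pow S)" using labels(1) by (auto intro: finite_subset)
    fix T U
    assume "T \<in> Pow S" "U \<in> Pow S" "T \<noteq> U"
    hence "P \<union> T \<noteq> P \<union> U" using labels(3) by blast
    thus "?A T \<times> ?B T \<inter> ?A U \<times> ?B U = {}" by (auto simp: andre_words_iff)
  qed simp
  finally show ?thesis by (simp add: card_cartesian_product andre_count_def)
qed

lemma andre_count_split:
  assumes "\<And>T. T \<subseteq> S \<Longrightarrow> real (andre_count R\<^sub>1 (P \<union> T)) = sps_nth f T"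
    and "\<And>T. T \<subseteq> S \<Longrightarrow> real (andre_count R\<^sub>2 (insert M (Q \<union> T))) = sps_nth g T"
  shows "real (andre_count R Y) = sps_nth (f * g) S"
  unfolding andre_count_eq_sum of_nat_sum of_nat_mult sps_mult_nth
  by (intro sum.cong) (auto simp: assms)

end

lemma hd_append_Cons_eq_iff: "p \<noteq> x \<Longrightarrow> hd (v @ x # v') = p \<longleftrightarrow> p \<in> set v \<and> hd v = p"
  by (cases v) auto

lemma hd_append_Cons_eq_self_iff: "x \<notin> set v \<Longrightarrow> hd (v @ x # v') = x \<longleftrightarrow> v = []"
  by (cases v) auto

lemma next_to_last_in_set: "w \<noteq> [] \<Longrightarrow> next_to_last w \<in> set w"
  by (simp add: next_to_last_def)

lemma next_to_last_append_Cons: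
  assumes "v' \<noteq> []"
  shows "next_to_last (v @ x # v') = (if length v' = 1 then x else next_to_last v')"
proof (cases "length v' = 1")
  case False
  hence "length v' \<ge> 2" using assms by (cases v') (auto simp: Suc_le_eq)
  then obtain k where "length v' = Suc (Suc k)" by (metis add_2_eq_Suc le_Suc_ex)
  thus ?thesis by (simp add: next_to_last_def nth_append)
qed (simp add: next_to_last_def nth_append)

lemma next_to_last_append_Cons_eq_iff:
  assumes "M \<in> set v'" "r \<noteq> x" "r \<noteq> M"
  shows "next_to_last (v @ x # v') = r \<longleftrightarrow> r \<in> set v' \<and> next_to_last v' = r"
proof (cases "length v' = 1")
  case True
  hence "v' = [M]" using assms(1) by (auto simp: length_Suc_conv)
  thus ?thesis using assms(2,3) by (simp add: next_to_last_append_Cons)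
next
  case False
  have "v' \<noteq> []" using assms(1) by auto
  thus ?thesis using False next_to_last_in_set [of v'] by (auto simp: next_to_last_append_Cons)
qed

lemma next_to_last_append_Cons_eq_self_iff:
  assumes "M \<in> set v'" "x \<notin> set v'"
  shows "next_to_last (v @ x # v') = x \<longleftrightarrow> v' = [M]"
proof (cases "length v' = 1")
  case True
  hence "v' = [M]" using assms(1) by (auto simp: length_Suc_conv)
  thus ?thesis by (simp add: next_to_last_append_Cons)
next
  case False
  have "v' \<noteq> []" using assms(1) by auto
  thus ?thesis
    using False next_to_last_in_set [of v'] assms(2) by (auto simp: next_to_last_append_Cons)
qed

lemma andre_I_last: "andre_I w \<Longrightarrow> w \<noteq> [] \<Longrightarrow> last w = Max (set w)"
proof (induction rule: andre_I.induct)
  case (split v v' x)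
  have Max_right: "Max (set (v @ v')) \<in> set v'" by fact
  have "x \<le> Max (set (v @ v'))"
    using Max_right by (subst \<open>x = Min _\<close>, intro Min_le) auto
  hence "Max (set (v @ x # v')) = Max (set (v @ v'))"
    using \<open>v @ v' \<noteq> []\<close> by (simp add: max_absorb2)
  also have "\<dots> = Max (set v')" using Max_right by (intro Max_eqI [symmetric]) auto
  finally show ?case using split.IH(2) Max_right by auto
qed auto

section \<open>Closed forms for the counting functions\<close>

lemma insert_Min_Max_cases:
  fixes S :: "'a :: linorder set"
  assumes "finite S"
  obtains (empty) "S = {}"
  | (singleton) x where "S = {x}"
  | (insert_Min_Max) x M S' where "S = insert x (insert M S')" "x < M" "S' \<subseteq> {x<..<M}"
proof (cases "S = {} \<or> (\<exists>x. S = {x})")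
  case True
  thus ?thesis using empty singleton by blast
next
  case False
  hence ne: "S \<noteq> {}" by simp
  have "Min S \<noteq> Max S"
    using False assms by (metis Min.coboundedI Max.coboundedI antisym is_singletonI' is_singletonE)
  hence "Min S < Max S" using assms ne by (simp add: le_neq_trans)
  moreover have "S = insert (Min S) (insert (Max S) (S - {Min S, Max S}))"
    using assms ne Min_in Max_in by blast
  moreover have "S - {Min S, Max S} \<subseteq> {Min S<..<Max S}"
    using Min_le [OF assms] Max_ge [OF assms] by (auto simp: less_le)
  ultimately show ?thesis using insert_Min_Max by blast
qed

lemma andre_count_True:
  assumes "finite S" "0 \<notin> S"
  shows "real (andre_count (\<lambda>_. True) S) = sps_nth Euler S"
  using assms
proof (induction S rule: finite_psubset_induct)
  case (psubset S)
  from psubset.hyps show ?case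
  proof (cases rule: insert_Min_Max_cases)
    case empty
    thus ?thesis by (simp add: andre_count_def andre_words_empty egf_nth fps_tan_sec_nth_0)
  next
    case (singleton x)
    thus ?thesis
      using psubset.prems fps_deriv_tan_sec_nth_0 [where 'a = real]
      by (simp add: andre_count_def andre_words_singleton egf_nth)
  next
    case (insert_Min_Max x M Y)
    hence Y: "finite Y" "M \<notin> Y" "x \<notin> insert M Y" using finite_subset by auto
    have "real (andre_count (\<lambda>_. True) S) = sps_nth (Euler * Euler') Y"
    proof (rule andre_count_split [where P = "{}" and Q = "{}"])
      fix T
      assume T: "T \<subseteq> Y"
      hence "T \<subset> S" "insert M T \<subset> S" "0 \<notin> insert M T" using insert_Min_Max Y psubset.prems by auto
      moreover have "sps_nth Euler (insert M T) = (sps_nth Euler' T :: real)"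
        using T Y by (intro sps_nth_insert [OF Euler_has_deriv]) (auto intro: finite_subset)
      ultimately show "real (andre_count (\<lambda>_. True) ({} \<union> T)) = sps_nth Euler T"
        "real (andre_count (\<lambda>_. True) (insert M ({} \<union> T))) = sps_nth Euler' T"
        using psubset.IH [of T] psubset.IH [of "insert M T"] by simp_all
    qed (use insert_Min_Max psubset.prems in auto)
    also have "\<dots> = sps_nth Euler S"
      unfolding insert_Min_Max(1) using Y by (intro Euler_nth_insert_insert [symmetric]) auto
    finally show ?thesis .
  qed
qed

lemma andre_count_True_insert:
  assumes "finite S" "0 \<notin> S" "0 < M" "M \<notin> S"
  shows "real (andre_count (\<lambda>_. True) (insert M S)) = sps_nth Euler' S"
  using assms andre_count_True [of "insert M S"] sps_nth_insert [OF Euler_has_deriv, of S M] by simp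

lemma andre_count_first_Min:
  assumes "0 < p" "p < M" "S \<subseteq> {p<..<M}"
  shows "real (andre_count (\<lambda>w. hd w = p) (insert p (insert M S))) = sps_nth Euler (insert M S)"
proof -
  have S: "finite S" "0 \<notin> S" "M \<notin> S" using assms by (auto intro: finite_subset)
  have "real (andre_count (\<lambda>w. hd w = p) (insert p (insert M S))) = sps_nth (1 * Euler') S"
  proof (rule andre_count_split [where P = "{}" and Q = "{}"])
    fix v v' :: "nat list"
    assume "distinct (v @ p # v')"
    thus "hd (v @ p # v') = p \<longleftrightarrow> {} \<subseteq> set v \<and> {} \<subseteq> set v' \<and> v = [] \<and> True"
      by (simp add: hd_append_Cons_eq_self_iff)
  next
    fix T
    assume "T \<subseteq> S"
    thus "real (andre_count (\<lambda>_. True) (insert M ({} \<union> T))) = sps_nth Euler' T"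
      using S assms(1,2) by (subst andre_count_True_insert) (auto intro: finite_subset)
  qed (use assms in \<open>simp_all add: andre_count_eq_Nil\<close>)
  thus ?thesis using S by (simp add: sps_nth_insert [OF Euler_has_deriv])
qed

lemma andre_count_first_Max:
  assumes "finite S" "S \<noteq> {}" "\<And>y. y \<in> S \<Longrightarrow> y < p"
  shows "andre_count (\<lambda>w. hd w = p) (insert p S) = 0"
proof -
  have "hd w \<noteq> p" if w: "w \<in> andre_words (insert p S)" for w
  proof
    assume "hd w = p"
    have "w \<noteq> []" using w by (auto simp: andre_words_iff)
    moreover have "Max (insert p S) = p" using assms by (intro Max_eqI) (auto dest: less_imp_le)
    ultimately have "last w = hd w" using w andre_I_last \<open>hd w = p\<close> by (auto simp: andre_words_iff)
    hence "w = [p]"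
      using w \<open>w \<noteq> []\<close> \<open>hd w = p\<close> by (cases w) (auto simp: andre_words_iff split: if_splits)
    thus False using w assms by (auto simp: andre_words_iff)
  qed
  thus ?thesis by (auto simp: andre_count_def)
qed

lemma andre_count_first_split:
  assumes "0 < x" "x < p" "p < M" "S \<subseteq> {x<..<M}" "p \<notin> S"
    and IH: "\<And>T. T \<subseteq> S \<Longrightarrow> real (andre_count (\<lambda>w. hd w = p) (insert p T)) = sps_nth f T"
  shows "real (andre_count (\<lambda>w. hd w = p) (insert x (insert M (insert p S)))) =
    sps_nth (f * Euler') S"
proof (rule andre_count_split [where P = "{p}" and Q = "{}"])
  fix v v' :: "nat list"
  show "hd (v @ x # v') = p \<longleftrightarrow> {p} \<subseteq> set v \<and> {} \<subseteq> set v' \<and> hd v = p \<and> True"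
    using assms(2) by (simp add: hd_append_Cons_eq_iff)
next
  fix T
  assume T: "T \<subseteq> S"
  thus "real (andre_count (\<lambda>w. hd w = p) ({p} \<union> T)) = sps_nth f T"
    using IH by simp
  have "finite T" "0 \<notin> T" "M \<notin> T" "0 < M"
    using T assms finite_subset [of T "{x<..<M}"] by auto
  thus "real (andre_count (\<lambda>_. True) (insert M ({} \<union> T))) = sps_nth Euler' T"
    using andre_count_True_insert by simp
qed (use assms in auto)

lemma relative_Min_Max_cases:
  fixes S :: "'a :: linorder set"
  assumes "finite S" "p \<notin> S"
  obtains (empty) "S = {}"
  | (Min) M S' where "S = insert M S'" "p < M" "S' \<subseteq> {p<..<M}"
  | (Max) "S \<noteq> {}" "S \<subseteq> {..<p}"
  | (between) x M S' where "S = insert x (insert M S')" "x < p" "p < M" "S' \<subseteq> {x<..<M}"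
proof (cases "S = {} \<or> S \<subseteq> {..<p}")
  case True
  thus ?thesis using empty Max by blast
next
  case False
  hence ne: "S \<noteq> {}" by simp
  have S_bounds: "S \<subseteq> {Min S..Max S}" using assms(1) by auto
  have in_S: "Min S \<in> S" "Max S \<in> S" using assms(1) ne by auto
  obtain y where "y \<in> S" "p < y"
    using False assms(2) by (metis lessThan_iff linorder_neqE subsetI)
  hence "p < Max S" using Max_ge [OF assms(1)] less_le_trans by blast
  show ?thesis
  proof (cases "p < Min S")
    case True
    show ?thesis
    proof (rule Min [OF _ \<open>p < Max S\<close>])
      show "S = insert (Max S) (S - {Max S})" using in_S(2) by blast
      show "S - {Max S} \<subseteq> {p<..<Max S}" using S_bounds True by (auto simp: subset_eq less_le)
    qed
  next
    case False
    hence "Min S < p" using in_S(1) assms(2) by (metis linorder_neqE)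
    show ?thesis
    proof (rule between [OF _ \<open>Min S < p\<close> \<open>p < Max S\<close>])
      show "S = insert (Min S) (insert (Max S) (S - {Min S, Max S}))" using in_S by blast
      show "S - {Min S, Max S} \<subseteq> {Min S<..<Max S}" using S_bounds by (auto simp: subset_eq less_le)
    qed
  qed
qed

lemma andre_count_first:
  assumes "finite S" "0 \<notin> S" "0 < p" "p \<notin> S"
  shows "real (andre_count (\<lambda>w. hd w = p) (insert p S)) = sps_nth (first_gf {p..}) S"
  using assms(1,2,4)
proof (induction S rule: finite_psubset_induct)
  case (psubset S)
  from psubset.hyps psubset.prems(2) show ?case
  proof (cases rule: relative_Min_Max_cases)
    case empty
    have "{w. w = [p] \<and> hd w = p} = {[p]}" by auto
    moreover have "sps_nth (first_gf {p..}) S = (sps_nth (first_gf {}) S :: real)"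
      using empty by (intro first_gf_nth_cong) auto
    ultimately show ?thesis
      using empty assms(3) by (simp add: andre_count_def andre_words_singleton sps_one_nth)
  next
    case (Min M S')
    hence "S \<inter> {p..} = S \<inter> UNIV" by (auto simp: subset_eq less_imp_le)
    hence "sps_nth (first_gf {p..}) S = (sps_nth (first_gf UNIV) S :: real)"
      by (rule first_gf_nth_cong [OF psubset.hyps])
    thus ?thesis using andre_count_first_Min [of p M S'] Min assms(3) by simp
  next
    case Max
    hence less: "\<And>y. y \<in> S \<Longrightarrow> y < p" by auto
    hence "sps_nth (first_gf {p..}) S = (sps_nth (first_gf {}) S :: real)"
      by (intro first_gf_nth_cong [OF psubset.hyps]) (auto dest: less)
    thus ?thesis
      using andre_count_first_Max [OF psubset.hyps Max(1) less] Max(1) by (simp add: sps_one_nth)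
  next
    case (between x M S')
    have S': "finite S'" "M \<notin> S'" "x \<notin> insert M S'" "p \<notin> S'" "0 < x"
      using between psubset.prems finite_subset [of S' "{x<..<M}"] by auto
    have "insert p S = insert x (insert M (insert p S'))" using between(1) by auto
    also have "real (andre_count (\<lambda>w. hd w = p) \<dots>) = sps_nth (first_gf {p..} * Euler') S'"
    proof (rule andre_count_first_split)
      fix T
      assume "T \<subseteq> S'"
      hence "T \<subset> S" using S' between(1) by auto
      thus "real (andre_count (\<lambda>w. hd w = p) (insert p T)) = sps_nth (first_gf {p..}) T"
        using psubset.IH psubset.prems by auto
    qed (use S' between in auto)
    also have "\<dots> = sps_nth (first_gf {p..}) S"
      unfolding between(1) using S' between(2,3)
      by (intro first_gf_nth_insert_insert [symmetric]) auto
    finally show ?thesis .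
  qed
qed

lemma greater_or_insert_Min_cases:
  fixes r :: "'a :: linorder"
  assumes "finite S" "r \<notin> S"
  obtains (greater) "S \<subseteq> {r<..}"
  | (insert_Min) x S' where "S = insert x S'" "finite S'" "x < r" "S' \<subseteq> {x<..}"
proof (cases "S \<subseteq> {r<..}")
  case False
  then obtain y where y: "y \<in> S" "y < r"
    using assms(2) by (metis greaterThan_iff linorder_neqE subsetI)
  hence "S = insert (Min S) (S - {Min S})" using Min_in [OF assms(1)] by auto
  moreover have "Min S < r" using Min_le [OF assms(1) y(1)] y(2) by simp
  moreover have "S - {Min S} \<subseteq> {Min S<..}" using Min_le [OF assms(1)] by (auto simp: less_le)
  ultimately show ?thesis using insert_Min assms(1) by blast
qed (use greater in blast)

lemma andre_count_next_to_last_Min: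
  assumes "0 < r" "r < M" "S \<subseteq> {r<..<M}"
  shows "real (andre_count (\<lambda>w. next_to_last w = r) (insert M (insert r S))) = sps_nth Euler S"
proof -
  have "real (andre_count (\<lambda>w. next_to_last w = r) (insert M (insert r S))) = sps_nth (Euler * 1) S"
  proof (rule andre_count_split [where x = r and P = "{}" and Q = "{}"])
    fix v v' :: "nat list"
    assume "distinct (v @ r # v')" "M \<in> set v'"
    thus "next_to_last (v @ r # v') = r \<longleftrightarrow> {} \<subseteq> set v \<and> {} \<subseteq> set v' \<and> True \<and> v' = [M]"
      by (simp add: next_to_last_append_Cons_eq_self_iff)
  next
    fix T
    assume "T \<subseteq> S"
    hence "finite T" "0 \<notin> T" "M \<notin> T" "0 < M"
      using assms finite_subset [of T "{r<..<M}"] by auto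
    thus "real (andre_count (\<lambda>_. True) ({} \<union> T)) = sps_nth Euler T"
      "real (andre_count (\<lambda>w. w = [M]) (insert M ({} \<union> T))) = sps_nth 1 T"
      by (simp_all add: andre_count_True andre_count_eq_singleton)
  qed (use assms in auto)
  thus ?thesis by simp
qed

lemma andre_count_next_to_last_split:
  assumes "0 < x" "x < r" "r < M" "S \<subseteq> {x<..<M}" "r \<notin> S"
    and IH: "\<And>T. T \<subseteq> S \<Longrightarrow>
      real (andre_count (\<lambda>w. next_to_last w = r) (insert M (insert r T))) = sps_nth g T"
  shows "real (andre_count (\<lambda>w. next_to_last w = r) (insert M (insert r (insert x S)))) =
    sps_nth (Euler * g) S"
proof (rule andre_count_split [where x = x and P = "{}" and Q = "{r}"])
  fix v v' :: "nat list"
  assume "M \<in> set v'"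
  thus "next_to_last (v @ x # v') = r \<longleftrightarrow>
      {} \<subseteq> set v \<and> {r} \<subseteq> set v' \<and> True \<and> next_to_last v' = r"
    using assms by (subst next_to_last_append_Cons_eq_iff) auto
next
  fix T
  assume T: "T \<subseteq> S"
  hence "finite T" "0 \<notin> T" using assms(4) finite_subset [of T "{x<..<M}"] by auto
  thus "real (andre_count (\<lambda>_. True) ({} \<union> T)) = sps_nth Euler T"
    by (simp add: andre_count_True)
  show "real (andre_count (\<lambda>w. next_to_last w = r) (insert M ({r} \<union> T))) = sps_nth g T"
    using IH [OF T] by simp
qed (use assms in auto)

lemma andre_count_next_to_last:
  assumes "S \<subseteq> {0<..<M}" "0 < r" "r < M" "r \<notin> S"
  shows "real (andre_count (\<lambda>w. next_to_last w = r) (insert M (insert r S))) =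
    sps_nth (next_to_last_gf {r..}) S"
proof -
  have "finite S" using assms(1) finite_subset by blast
  thus ?thesis
    using assms(1,4)
  proof (induction S rule: finite_psubset_induct)
    case (psubset S)
    from psubset.hyps psubset.prems(2) show ?case
    proof (cases rule: greater_or_insert_Min_cases)
      case greater
      hence "S \<subseteq> {r<..<M}" using psubset.prems(1) by (auto simp: subset_eq)
      hence "real (andre_count (\<lambda>w. next_to_last w = r) (insert M (insert r S))) =
          sps_nth (next_to_last_gf UNIV) S"
        using assms(2,3) by (simp add: andre_count_next_to_last_Min)
      also have "\<dots> = sps_nth (next_to_last_gf {r..}) S"
        using greater by (intro next_to_last_gf_nth_cong [OF psubset.hyps]) auto
      finally show ?thesis .
    next
      case (insert_Min x S')
      have "real (andre_count (\<lambda>w. next_to_last w = r) (insert M (insert r (insert x S')))) =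
          sps_nth (Euler * next_to_last_gf {r..}) S'"
      proof (rule andre_count_next_to_last_split)
        fix T
        assume "T \<subseteq> S'"
        hence "T \<subset> S" using insert_Min by auto
        thus "real (andre_count (\<lambda>w. next_to_last w = r) (insert M (insert r T))) =
            sps_nth (next_to_last_gf {r..}) T"
          using psubset.IH psubset.prems by auto
      qed (use insert_Min psubset.prems assms in \<open>auto simp: subset_eq\<close>)
      also have "\<dots> = sps_nth (next_to_last_gf {r..}) (insert x S')"
        using insert_Min by (intro sps_nth_insert [symmetric] next_to_last_gf_has_deriv) auto
      finally show ?thesis unfolding insert_Min(1) .
    qed
  qed
qed

abbreviation joint_count :: "nat \<Rightarrow> nat \<Rightarrow> nat set \<Rightarrow> nat" where
  "joint_count p r \<equiv> andre_count (\<lambda>w. hd w = p \<and> next_to_last w = r)"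

lemma joint_count_split:
  assumes "0 < x" "x < p" "p < M" "x < r" "r < M" "p \<noteq> r" "S \<subseteq> {x<..<M}" "p \<notin> S" "r \<notin> S"
  shows "real (joint_count p r (insert x (insert M (insert r (insert p S))))) =
    sps_nth (first_gf {p..} * next_to_last_gf {r..}) S"
proof (rule andre_count_split [where P = "{p}" and Q = "{r}"])
  fix v v' :: "nat list"
  assume "M \<in> set v'"
  thus "hd (v @ x # v') = p \<and> next_to_last (v @ x # v') = r \<longleftrightarrow>
      {p} \<subseteq> set v \<and> {r} \<subseteq> set v' \<and> hd v = p \<and> next_to_last v' = r"
    using assms by (auto simp: hd_append_Cons_eq_iff next_to_last_append_Cons_eq_iff)
next
  fix T
  assume "T \<subseteq> S"
  hence "T \<subseteq> {0<..<M}" "finite T" "0 \<notin> T" "p \<notin> T" "r \<notin> T"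
    using assms finite_subset [of T "{x<..<M}"] by fastforce+
  thus "real (andre_count (\<lambda>w. hd w = p) ({p} \<union> T)) = sps_nth (first_gf {p..}) T"
    "real (andre_count (\<lambda>w. next_to_last w = r) (insert M ({r} \<union> T))) =
      sps_nth (next_to_last_gf {r..}) T"
    using andre_count_first [of T p] andre_count_next_to_last [of T M r] assms by simp_all
qed (use assms in auto)

lemma joint_count_first_Min:
  assumes "0 < p" "p < r" "r < M" "S \<subseteq> {p<..<M}" "r \<notin> S"
  shows "real (joint_count p r (insert M (insert r (insert p S)))) =
    sps_nth (next_to_last_gf {r..}) S"
proof -
  have "real (joint_count p r (insert M (insert r (insert p S)))) =
      sps_nth (1 * next_to_last_gf {r..}) S"
  proof (rule andre_count_split [where x = p and P = "{}" and Q = "{r}"])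
    fix v v' :: "nat list"
    assume "distinct (v @ p # v')" "M \<in> set v'"
    thus "hd (v @ p # v') = p \<and> next_to_last (v @ p # v') = r \<longleftrightarrow>
        {} \<subseteq> set v \<and> {r} \<subseteq> set v' \<and> v = [] \<and> next_to_last v' = r"
      using assms by (auto simp: hd_append_Cons_eq_self_iff next_to_last_append_Cons_eq_iff)
  next
    fix T
    assume "T \<subseteq> S"
    hence "T \<subseteq> {0<..<M}" "r \<notin> T" using assms by fastforce+
    thus "real (andre_count (\<lambda>w. next_to_last w = r) (insert M ({r} \<union> T))) =
        sps_nth (next_to_last_gf {r..}) T"
      using andre_count_next_to_last [of T M r] assms by simp
  qed (use assms in \<open>auto simp: andre_count_eq_Nil\<close>)
  thus ?thesis by simp
qed

lemma joint_count_next_to_last_Min: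
  assumes "0 < r" "r < p" "p < M" "S \<subseteq> {r<..<M}" "p \<notin> S"
  shows "real (joint_count p r (insert M (insert r (insert p S)))) = sps_nth (first_gf {p..}) S"
proof -
  have "real (joint_count p r (insert M (insert r (insert p S)))) = sps_nth (first_gf {p..} * 1) S"
  proof (rule andre_count_split [where x = r and P = "{p}" and Q = "{}"])
    fix v v' :: "nat list"
    assume "distinct (v @ r # v')" "M \<in> set v'"
    thus "hd (v @ r # v') = p \<and> next_to_last (v @ r # v') = r \<longleftrightarrow>
        {p} \<subseteq> set v \<and> {} \<subseteq> set v' \<and> hd v = p \<and> v' = [M]"
      using assms by (auto simp: hd_append_Cons_eq_iff next_to_last_append_Cons_eq_self_iff)
  next
    fix T
    assume "T \<subseteq> S"
    hence "finite T" "0 \<notin> T" "p \<notin> T" "M \<notin> T" "0 < M"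
      using assms finite_subset [of T "{r<..<M}"] by auto
    thus "real (andre_count (\<lambda>w. hd w = p) ({p} \<union> T)) = sps_nth (first_gf {p..}) T"
      "real (andre_count (\<lambda>w. w = [M]) (insert M ({} \<union> T))) = sps_nth 1 T"
      using andre_count_first [of T p] assms by (simp_all add: andre_count_eq_singleton)
  qed (use assms in auto)
  thus ?thesis by simp
qed

lemma joint_count_less:
  assumes "S \<subseteq> {0<..<M}" "0 < p" "p < r" "r < M" "p \<notin> S" "r \<notin> S"
  shows "real (joint_count p r (insert M (insert r (insert p S)))) =
    sps_nth (joint_less_gf {..<p} {r..}) S"
proof -
  have fin: "finite S" using assms(1) finite_subset by blast
  from this assms(5) show ?thesis
  proof (cases rule: greater_or_insert_Min_cases)
    case greater
    hence "S \<subseteq> {p<..<M}" using assms(1) by (auto simp: subset_eq)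
    hence "real (joint_count p r (insert M (insert r (insert p S)))) =
        sps_nth (joint_less_gf {} {r..}) S"
      using assms by (simp add: joint_count_first_Min)
    also have "\<dots> = sps_nth (joint_less_gf {..<p} {r..}) S"
      using greater by (intro joint_less_gf_nth_cong [OF fin]) auto
    finally show ?thesis .
  next
    case (insert_Min x S')
    have "insert M (insert r (insert p S)) = insert x (insert M (insert r (insert p S')))"
      using insert_Min by auto
    hence "real (joint_count p r (insert M (insert r (insert p S)))) =
        sps_nth (first_gf (- {..<p}) * next_to_last_gf {r..}) S'"
      using joint_count_split [of x p M r S'] insert_Min assms by (simp add: subset_eq)
    also have "\<dots> = sps_nth (joint_less_gf {..<p} {r..}) S"
      unfolding insert_Min(1) using insert_Min assms(3)
      by (intro sps_nth_insert [symmetric] joint_less_gf_has_deriv) auto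
    finally show ?thesis .
  qed
qed

lemma joint_count_greater:
  assumes "S \<subseteq> {0<..<M}" "0 < r" "r < p" "p < M" "p \<notin> S" "r \<notin> S"
  shows "real (joint_count p r (insert M (insert r (insert p S)))) =
    sps_nth (joint_greater_gf {..<r} {p..}) S"
proof -
  have fin: "finite S" using assms(1) finite_subset by blast
  from this assms(6) show ?thesis
  proof (cases rule: greater_or_insert_Min_cases)
    case greater
    hence "S \<subseteq> {r<..<M}" using assms(1) by (auto simp: subset_eq)
    hence "real (joint_count p r (insert M (insert r (insert p S)))) =
        sps_nth (joint_greater_gf {} {p..}) S"
      using assms by (simp add: joint_count_next_to_last_Min)
    also have "\<dots> = sps_nth (joint_greater_gf {..<r} {p..}) S"
      using greater by (intro joint_greater_gf_nth_cong [OF fin]) auto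
    finally show ?thesis .
  next
    case (insert_Min x S')
    have "insert M (insert r (insert p S)) = insert x (insert M (insert r (insert p S')))"
      using insert_Min by auto
    hence "real (joint_count p r (insert M (insert r (insert p S)))) =
        sps_nth (first_gf {p..} * next_to_last_gf (- {..<r})) S'"
      using joint_count_split [of x p M r S'] insert_Min assms by (simp add: subset_eq)
    also have "\<dots> = sps_nth (joint_greater_gf {..<r} {p..}) S"
      unfolding insert_Min(1) using insert_Min assms(3)
      by (intro sps_nth_insert [symmetric] joint_greater_gf_has_deriv) auto
    finally show ?thesis .
  qed
qed

section \<open>Symmetry and the Entringer recurrence\<close>

lemma image_minus_Diff_doubleton:
  fixes n p r :: nat
  assumes "p < n" "r < n"
  shows "(\<lambda>i. n - i) ` ({1..<n} - {p, r}) = {1..<n} - {n - p, n - r}"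
proof (intro set_eqI iffI)
  fix y
  assume "y \<in> {1..<n} - {n - p, n - r}"
  thus "y \<in> (\<lambda>i. n - i) ` ({1..<n} - {p, r})" by (intro image_eqI [of _ _ "n - y"]) auto
qed (use assms in auto)

lemma joint_count_reflect:
  assumes "0 < p" "p < n" "0 < r" "r < n" "p \<noteq> r"
  shows "joint_count p r {1..n} = joint_count (n - r) (n - p) {1..n}"
proof -
  define S where "S = {1..<n} - {p, r}"
  let ?h = "\<lambda>i. n - i"
  have S: "S \<subseteq> {0<..<n}" "p \<notin> S" "r \<notin> S" "finite S" "inj_on ?h S"
    by (auto simp: S_def inj_on_def)
  have image_eq: "?h ` S = {1..<n} - {n - p, n - r}"
    unfolding S_def by (rule image_minus_Diff_doubleton) fact+
  have insert_eq: "{1..n} = insert n (insert r (insert p S))"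
    "{1..n} = insert n (insert (n - p) (insert (n - r) (?h ` S)))"
    unfolding image_eq using assms by (auto simp: S_def)
  have preimage: "S \<inter> ?h -` {..<n - i} = S \<inter> {i..}" "S \<inter> ?h -` {n - i..} = S \<inter> {..<i}"
    if "i = p \<or> i = r" for i
    using that assms by (auto simp: S_def)
  have "real (joint_count p r {1..n}) = real (joint_count (n - r) (n - p) {1..n})"
  proof (cases "p < r")
    case True
    have "real (joint_count p r {1..n}) = sps_nth (joint_less_gf {..<p} {r..}) S"
      unfolding insert_eq(1) using S assms True by (intro joint_count_less) auto
    also have "\<dots> = sps_nth (joint_less_gf {..<n - r} {n - p..}) (?h ` S)"
      by (subst joint_less_gf_commute) (simp add: joint_less_gf_nth_image [OF S(4,5) preimage])
    also have "\<dots> = real (joint_count (n - r) (n - p) {1..n})"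
      unfolding insert_eq(2) using assms True
      by (intro joint_count_less [symmetric]) (auto simp: image_eq)
    finally show ?thesis .
  next
    case False
    have "real (joint_count p r {1..n}) = sps_nth (joint_greater_gf {..<r} {p..}) S"
      unfolding insert_eq(1) using S assms False by (intro joint_count_greater) auto
    also have "\<dots> = sps_nth (joint_greater_gf {..<n - p} {n - r..}) (?h ` S)"
      by (subst joint_greater_gf_commute)
         (simp add: joint_greater_gf_nth_image [OF S(4,5) preimage])
    also have "\<dots> = real (joint_count (n - r) (n - p) {1..n})"
      unfolding insert_eq(2) using assms False
      by (intro joint_count_greater [symmetric]) (auto simp: image_eq)
    finally show ?thesis .
  qed
  thus ?thesis by simp
qed

lemma first_gf_entringer_rec:
  fixes m n :: nat
  assumes "1 \<le> m" "m < n"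
  shows "sps_nth (first_gf {m..}) ({1..n} - {m}) =
    sps_nth (first_gf {m + 1..}) ({1..n} - {m + 1}) +
    (sps_nth (first_gf {n - m..}) ({1..n - 1} - {n - m}) :: 'a :: field_char_0)"
proof -
  define U where "U = {1..n} - {m, m + 1}"
  let ?h = "\<lambda>i. if i < m then n - i else n + 1 - i"
  have U: "finite U" "m \<notin> U" "m + 1 \<notin> U" "inj_on ?h U"
    using assms by (auto simp: U_def inj_on_def split: if_splits)
  have insert_eq: "{1..n} - {m} = insert (m + 1) U" "{1..n} - {m + 1} = insert m U"
    using assms by (auto simp: U_def)
  have image_eq: "?h ` U = {1..n - 1} - {n - m}"
  proof (intro set_eqI iffI)
    fix y
    assume "y \<in> {1..n - 1} - {n - m}"
    thus "y \<in> ?h ` U"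
      using assms
      by (intro image_eqI [of _ _ "if y < n - m then n + 1 - y else n - y"]) (auto simp: U_def)
  qed (use assms in \<open>auto simp: U_def\<close>)
  have "sps_nth (first_gf {m..}) ({1..n} - {m}) =
      (sps_nth (Euler' * Sin {m..} + first_gf (- {m..})) U :: 'a)"
    unfolding insert_eq using U by (intro sps_nth_insert first_gf_has_deriv_in) auto
  also have "\<dots> = sps_nth (Euler' * Sin {m + 1..}) U + sps_nth (first_gf (- {m..})) U"
  proof -
    have "U \<inter> {m..} = U \<inter> {m + 1..}" by (auto simp: U_def Suc_le_eq le_less)
    thus ?thesis using U
      by (simp, intro sps_nth_eqI) (simp_all add: sps_pullback_mult sps_pullback_egf)
  qed
  also have "sps_nth (Euler' * Sin {m + 1..}) U =
      (sps_nth (first_gf {m + 1..}) ({1..n} - {m + 1}) :: 'a)"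
    unfolding insert_eq using U by (intro sps_nth_insert [symmetric] first_gf_has_deriv_notin) auto
  also have "sps_nth (first_gf (- {m..})) U =
      (sps_nth (first_gf {n - m..}) ({1..n - 1} - {n - m}) :: 'a)"
    unfolding image_eq [symmetric] using assms
    by (intro first_gf_nth_image [symmetric] U) (auto simp: U_def split: if_splits)
  finally show ?thesis .
qed

lemma andre_count_first_eq_entringer:
  assumes "1 \<le> m" "m \<le> n"
  shows "andre_count (\<lambda>w. hd w = m) {1..n} = entringer n m"
  using assms
proof (induction n m rule: entringer.induct)
  case (1 n m)
  have count: "real (andre_count (\<lambda>w. hd w = k) {1..l}) = sps_nth (first_gf {k..}) ({1..l} - {k})"
    if "1 \<le> k" "k \<le> l" for k l
    using that andre_count_first [of "{1..l} - {k}" k] by (simp add: insert_absorb)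
  consider (base) "n = 1" "m = 1" | (diag) "n \<ge> 2" "m = n" | (step) "m < n"
    using "1.prems" by linarith
  thus ?case
  proof cases
    case base
    have "{w. w = [Suc 0] \<and> hd w = Suc 0} = {[Suc 0]}" by auto
    thus ?thesis
      using base entringer_1_1 by (simp add: andre_count_def andre_words_singleton)
  next
    case diag
    have "andre_count (\<lambda>w. hd w = n) (insert n {1..<n}) = 0"
      using diag by (intro andre_count_first_Max) auto
    moreover have "insert n {1..<n} = {1..n}" using diag by auto
    ultimately show ?thesis using diag entringer_diag by simp
  next
    case step
    have "andre_count (\<lambda>w. hd w = m + 1) {1..n} = entringer n (m + 1)"
      using step "1.prems" by (intro "1.IH"(1)) auto
    moreover have "andre_count (\<lambda>w. hd w = n - m) {1..n - 1} = entringer (n - 1) (n - m)"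
      using step "1.prems" by (intro "1.IH"(2)) auto
    moreover have "real (andre_count (\<lambda>w. hd w = m) {1..n}) =
        real (andre_count (\<lambda>w. hd w = m + 1) {1..n}) +
        real (andre_count (\<lambda>w. hd w = n - m) {1..n - 1})"
      using count [of m n] count [of "m + 1" n] count [of "n - m" "n - 1"] step "1.prems"
        first_gf_entringer_rec [of m n] by simp
    ultimately show ?thesis using step "1.prems" by (simp add: entringer.simps [of n m])
  qed
qed

section \<open>The statistics on Andre permutations\<close>

lemma And_I_eq: "And_I n = andre_words {1..n}"
  by (simp add: And_I_def andre_words_def)

lemma And_I_bounds:
  assumes "w \<in> And_I n" "n \<ge> 2"
  shows "0 < hd w" "hd w < n" "0 < next_to_last w" "next_to_last w < n"
    and "n > 2 \<Longrightarrow> hd w \<noteq> next_to_last w"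
proof -
  have w: "distinct w" "set w = {1..n}" "andre_I w"
    using assms(1) by (auto simp: And_I_eq andre_words_iff)
  have len: "length w = n" using distinct_card [OF w(1)] w(2) by simp
  hence ne: "w \<noteq> []" using assms(2) by auto
  have hd: "hd w = w ! 0" using ne by (rule hd_conv_nth)
  have "last w = n"
    using andre_I_last [OF w(3) ne] w(2) assms(2) by (simp add: Max_eq_iff)
  hence last: "w ! (n - 1) = n" using ne len by (simp add: last_conv_nth)
  have in_set: "w ! i \<in> {1..n}" if "i < n" for i
    using that nth_mem [of i w] w(2) len by simp
  have diff: "w ! i \<noteq> w ! j" if "i < n" "j < n" "i \<noteq> j" for i j
    using that w(1) len by (simp add: nth_eq_iff_index_eq)
  have "hd w \<noteq> n" "next_to_last w \<noteq> n"
    using diff [of 0 "n - 1"] diff [of "n - 2" "n - 1"] last len assms(2)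
    by (auto simp: hd next_to_last_def)
  moreover have "hd w \<in> {1..n}" "next_to_last w \<in> {1..n}"
    using in_set [of 0] in_set [of "n - 2"] len assms(2) by (auto simp: hd next_to_last_def)
  ultimately show "0 < hd w" "hd w < n" "0 < next_to_last w" "next_to_last w < n" by auto
  show "hd w \<noteq> next_to_last w" if "n > 2"
    using diff [of 0 "n - 2"] len that by (simp add: hd next_to_last_def)
qed

lemma joint_count_diag:
  assumes "n > 2"
  shows "joint_count p p {1..n} = 0"
proof -
  have "{w \<in> andre_words {1..n}. hd w = p \<and> next_to_last w = p} = {}"
    using And_I_bounds(5) [of _ n] assms unfolding And_I_eq by fastforce
  thus ?thesis by (simp only: andre_count_def card.empty)
qed

lemma card_And_I_joint_symmetric:
  fixes p q :: int
  assumes "n \<ge> 2"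
  shows "card {w \<in> And_I n. int (first_letter w) = p \<and> int n - int (next_to_last w) = q} =
    card {w \<in> And_I n. int (first_letter w) = q \<and> int n - int (next_to_last w) = p}"
    (is "?N p q = ?N q p")
proof (cases "p \<in> {0<..<int n} \<and> q \<in> {0<..<int n}")
  case True
  have count_eq: "?N (int i) (int j) = joint_count i (n - j) {1..n}" if "j < n" for i j
    using that
    by (auto simp: andre_count_def And_I_eq first_letter_def intro!: arg_cong [of _ _ card])
  from True obtain i j where ij: "p = int i" "q = int j" "0 < i" "i < n" "0 < j" "j < n"
    by (metis greaterThanLessThan_iff of_nat_0_less_iff of_nat_less_iff pos_int_cases)
  have "joint_count i (n - j) {1..n} = joint_count j (n - i) {1..n}"
  proof (cases "i = n - j")
    case True
    hence "n - i = j" using ij by simp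
    moreover have "i = j" if "n = 2" using that ij by auto
    ultimately show ?thesis
      using True joint_count_diag [of n] assms by (cases "n = 2") auto
  next
    case False
    thus ?thesis using joint_count_reflect [of i n "n - j"] ij by simp
  qed
  thus ?thesis using count_eq ij by simp
next
  case False
  hence "{w \<in> And_I n. int (first_letter w) = p \<and> int n - int (next_to_last w) = q} = {}"
    "{w \<in> And_I n. int (first_letter w) = q \<and> int n - int (next_to_last w) = p} = {}"
    using And_I_bounds [OF _ assms] by (fastforce simp: first_letter_def)+
  thus ?thesis by (simp only:)
qed

lemma card_eq_if_joint_symmetric:
  assumes "finite A"
    and sym: "\<And>p q. card {w \<in> A. f w = p \<and> g w = q} = card {w \<in> A. f w = q \<and> g w = p}"
  shows "card {w \<in> A. g w = m} = card {w \<in> A. f w = m}"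
proof -
  let ?K = "f ` A \<union> g ` A"
  have marginal: "card {w \<in> A. h w = m} = (\<Sum>k\<in>?K. card {w \<in> A. h w = m \<and> h' w = k})"
    if "h' ` A \<subseteq> ?K" for h h'
  proof -
    have "{w \<in> A. h w = m} = (\<Union>k\<in>?K. {w \<in> A. h w = m \<and> h' w = k})"
      using that by blast
    thus ?thesis using assms(1) by (simp only:) (intro card_UN_disjoint, auto)
  qed
  have "card {w \<in> A. g w = m} = (\<Sum>k\<in>?K. card {w \<in> A. g w = m \<and> f w = k})"
    by (rule marginal) simp
  also have "\<dots> = (\<Sum>k\<in>?K. card {w \<in> A. f w = m \<and> g w = k})"
    using sym [of m] by (simp add: conj_commute)
  also have "\<dots> = card {w \<in> A. f w = m}"
    by (rule marginal [symmetric]) simp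
  finally show ?thesis .
qed

lemma card_And_I_first_letter:
  "m \<in> {1..n} \<Longrightarrow> card {w \<in> And_I n. first_letter w = m} = entringer n m"
  using andre_count_first_eq_entringer [of m n]
  by (simp add: andre_count_def And_I_eq first_letter_def)

lemma card_And_I: "real (card (And_I n)) = euler_number n"
  using andre_count_True [of "{1..n}"]
  by (simp add: andre_count_def And_I_eq egf_nth euler_number_def fps_tan_sec_def)

theorem theorem2p4:
  fixes n :: nat
  assumes "n \<ge> 2"
  shows
    "(\<forall>m\<in>{1..n}.
        card {w \<in> And_I n. first_letter w = m} = entringer n m \<and>
        card {w \<in> And_I n. int n - int (next_to_last w) = int m} = entringer n m) \<and>
     real (card (And_I n)) = euler_number n \<and>
     (\<forall>p q :: int.
        card {w \<in> And_I n. int (first_letter w) = p \<and> int n - int (next_to_last w) = q} =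
        card {w \<in> And_I n. int (first_letter w) = q \<and> int n - int (next_to_last w) = p})"
proof (intro conjI ballI allI)
  fix m
  assume m: "m \<in> {1..n}"
  show first: "card {w \<in> And_I n. first_letter w = m} = entringer n m"
    by (rule card_And_I_first_letter [OF m])
  have "card {w \<in> And_I n. int n - int (next_to_last w) = int m} =
      card {w \<in> And_I n. int (first_letter w) = int m}"
    by (rule card_eq_if_joint_symmetric [OF _ card_And_I_joint_symmetric [OF assms]])
       (simp add: And_I_eq)
  thus "card {w \<in> And_I n. int n - int (next_to_last w) = int m} = entringer n m"
    using first by simp
qed (rule card_And_I card_And_I_joint_symmetric [OF assms])+

end
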